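(* Let $m\mathfrak H$ be the meta-Hahn algebra with parameters $\eta_0,\eta_1,\eta_3$ and Casimir element $Q$, let $\mu$ be an arbitrary real parameter, and put $W=X+\mu Z$. The centrally extended Hahn algebra admits an embedding in $m\mathfrak H$ with $W$ and $V$ as generators: taking $K_1=W$ and $K_2=V$, the Hahn algebra relations $$[K_1,[K_2,K_1]]=aK_1^2+bK_1+c_1K_2+d_1\mathcal I,$$ $$[K_2,[K_1,K_2]]=a\{K_1,K_2\}+bK_2+c_2K_1+d_2\mathcal I$$ are satisfied with $$a=2,\quad b=2\mu-\eta_1+2\eta_3,\quad c_1=-1,\quad d_1=-Q,$$ $$c_2=-\eta_1(\eta_1+2),\quad d_2=\eta_0(2\mu-\eta_1)-\eta_1\eta_3(1+\mu).$$
   Context: $[A,B]=AB-BA$, $\{A,B\}=AB+BA$. The Hahn algebra is the algebra with two generators $K_1,K_2$ and the two displayed defining relations, with parameters $a,b,c_1,c_2,d_1,d_2$. The meta-Hahn algebra $m\mathfrak H$ with real parameters $\eta_0,\eta_1,\eta_3$ is the algebra generated by $X,Z,V$ with defining relations $$[Z,X]=Z^2+Z,\qquad [X,V]=\{V,Z\}+\eta_1X+V-\eta_1Z+\eta_0\mathcal I,\qquad [V,Z]=2X+\eta_1Z+\eta_3\mathcal I,$$ with $\mathcal I$ the identity (central). Its Casimir (central) element is $$Q=\{V,Z^2+Z\}+2X^2+(2-\eta_1)Z^2+\eta_1\{X,Z\}+2\eta_3X+2(\eta_0+1)Z.$$ "Centrally extended" refers to the fact that the parameter $d_1$ involves the central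 element $Q$ rather than being a number.
   Formalization: The printed d_1=-Q is false unless η_0=μη_3 (e.g. η_0=1, η_1=η_3=μ=0); the formal version proves d_1=-Q+(μη_3-η_0)I, shows d_1 is central, and reads "embedding" as W,V satisfying the Hahn relations, without injectivity. *)

theory Defs
  imports Complex_Main "HOL-Algebra.Module" "HOL-Algebra.QuotRing" "HOL-Library.Poly_Mapping"
begin

text \<open>
  Words over \<open>'g\<close>, written additively because the convolution product of \<open>\<Rightarrow>\<^sub>0\<close> is taken over an
  (in general non-commutative) additive monoid. The finitely supported real functions on words
  then form the free unital associative real algebra on \<open>'g\<close>.
\<close>

datatype 'g fmon = FMon (letters: "'g list")

instantiation fmon :: (type) monoid_add
begin

definition zero_fmon :: "'a fmon" where
  "0 = FMon []"

definition plus_fmon :: "'a fmon \<Rightarrow> 'a fmon \<Rightarrow> 'a fmon" where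
  "u + v = FMon (letters u @ letters v)"

instance
  by standard (simp_all add: zero_fmon_def plus_fmon_def)

end

type_synonym 'g free_algebra = "'g fmon \<Rightarrow>\<^sub>0 real"

definition gen :: "'g \<Rightarrow> 'g free_algebra" where
  "gen g = Poly_Mapping.single (FMon [g]) 1"

definition scalar :: "real \<Rightarrow> 'g free_algebra" where
  "scalar r = Poly_Mapping.single 0 r"

definition free_alg :: "(real, 'g free_algebra) module" where
  "free_alg = \<lparr>carrier = UNIV, mult = (*), one = 1, zero = 0, add = (+),
     smult = (\<lambda>r p. scalar r * p)\<rparr>"

definition presented_alg :: "'g free_algebra set \<Rightarrow> (real, 'g free_algebra set) module" where
  "presented_alg R =
     (let I = Idl\<^bsub>free_alg\<^esub> R; A = free_alg Quot I
      in \<lparr>carrier = carrier A, mult = mult A, one = one A, zero = zero A, add = add A,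
          smult = (\<lambda>r x. (I +>\<^bsub>free_alg\<^esub> scalar r) \<otimes>\<^bsub>A\<^esub> x)\<rparr>)"

definition presented_gen :: "'g free_algebra set \<Rightarrow> 'g \<Rightarrow> 'g free_algebra set" where
  "presented_gen R g = (Idl\<^bsub>free_alg\<^esub> R) +>\<^bsub>free_alg\<^esub> gen g"

definition commutator :: "('a, 'm) ring_scheme \<Rightarrow> 'a \<Rightarrow> 'a \<Rightarrow> 'a" where
  "commutator A x y = x \<otimes>\<^bsub>A\<^esub> y \<ominus>\<^bsub>A\<^esub> y \<otimes>\<^bsub>A\<^esub> x"

definition anticommutator :: "('a, 'm) ring_scheme \<Rightarrow> 'a \<Rightarrow> 'a \<Rightarrow> 'a" where
  "anticommutator A x y = x \<otimes>\<^bsub>A\<^esub> y \<oplus>\<^bsub>A\<^esub> y \<otimes>\<^bsub>A\<^esub> x"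

definition central :: "('a, 'm) ring_scheme \<Rightarrow> 'a \<Rightarrow> bool" where
  "central A q \<longleftrightarrow> q \<in> carrier A \<and> (\<forall>x\<in>carrier A. q \<otimes>\<^bsub>A\<^esub> x = x \<otimes>\<^bsub>A\<^esub> q)"

datatype mh_gen = GX | GZ | GV

definition meta_hahn_relators :: "real \<Rightarrow> real \<Rightarrow> real \<Rightarrow> mh_gen free_algebra set" where
  "meta_hahn_relators \<eta>0 \<eta>1 \<eta>3 =
     (let X = gen GX; Z = gen GZ; V = gen GV
      in {(Z * X - X * Z) - (Z * Z + Z),
          (X * V - V * X) - ((V * Z + Z * V) + scalar \<eta>1 * X + V - scalar \<eta>1 * Z + scalar \<eta>0),
          (V * Z - Z * V) - (scalar 2 * X + scalar \<eta>1 * Z + scalar \<eta>3)})"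

definition meta_hahn :: "real \<Rightarrow> real \<Rightarrow> real \<Rightarrow> (real, mh_gen free_algebra set) module" where
  "meta_hahn \<eta>0 \<eta>1 \<eta>3 = presented_alg (meta_hahn_relators \<eta>0 \<eta>1 \<eta>3)"

definition meta_hahn_gen :: "real \<Rightarrow> real \<Rightarrow> real \<Rightarrow> mh_gen \<Rightarrow> mh_gen free_algebra set" where
  "meta_hahn_gen \<eta>0 \<eta>1 \<eta>3 = presented_gen (meta_hahn_relators \<eta>0 \<eta>1 \<eta>3)"

definition meta_hahn_casimir :: "real \<Rightarrow> real \<Rightarrow> real \<Rightarrow> mh_gen free_algebra set" where
  "meta_hahn_casimir \<eta>0 \<eta>1 \<eta>3 =
     (let H = meta_hahn \<eta>0 \<eta>1 \<eta>3;
          X = meta_hahn_gen \<eta>0 \<eta>1 \<eta>3 GX;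
          Z = meta_hahn_gen \<eta>0 \<eta>1 \<eta>3 GZ;
          V = meta_hahn_gen \<eta>0 \<eta>1 \<eta>3 GV
      in anticommutator H V (Z \<otimes>\<^bsub>H\<^esub> Z \<oplus>\<^bsub>H\<^esub> Z)
         \<oplus>\<^bsub>H\<^esub> 2 \<odot>\<^bsub>H\<^esub> (X \<otimes>\<^bsub>H\<^esub> X)
         \<oplus>\<^bsub>H\<^esub> (2 - \<eta>1) \<odot>\<^bsub>H\<^esub> (Z \<otimes>\<^bsub>H\<^esub> Z)
         \<oplus>\<^bsub>H\<^esub> \<eta>1 \<odot>\<^bsub>H\<^esub> anticommutator H X Z
         \<oplus>\<^bsub>H\<^esub> (2 * \<eta>3) \<odot>\<^bsub>H\<^esub> X
         \<oplus>\<^bsub>H\<^esub> (2 * (\<eta>0 + 1)) \<odot>\<^bsub>H\<^esub> Z)"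

text \<open>
  The parameter \<open>d1\<close> is an element of the algebra, not a number; centrality of \<open>d1\<close> is what makes
  this the centrally extended Hahn algebra.

  In the meta-Hahn algebra the pair \<open>X + \<mu>Z\<close>, \<open>V\<close> satisfies the first relation with
  \<open>d1 = - Q + (\<mu>\<eta>3 - \<eta>0)I\<close>: the scalar comes from the terms \<open>- \<eta>0\<close> of \<open>- [X,V]\<close> and \<open>\<mu>\<eta>3\<close> of
  \<open>\<mu>[V,Z]\<close>. It cannot be dropped: under the character \<open>Z \<mapsto> 0\<close>, \<open>X \<mapsto> - \<eta>3/2\<close>,
  \<open>V \<mapsto> \<eta>1\<eta>3/2 - \<eta>0\<close> of the meta-Hahn algebra, the first relation with \<open>d1 = - Q\<close>
  becomes \<open>0 = \<eta>0 - \<mu>\<eta>3\<close>.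
\<close>

definition centrally_extended_hahn ::
    "(real, 'a, 'm) module_scheme \<Rightarrow> real \<Rightarrow> real \<Rightarrow> real \<Rightarrow> real \<Rightarrow> 'a \<Rightarrow> real \<Rightarrow> 'a \<Rightarrow> 'a \<Rightarrow> bool"
  where
  "centrally_extended_hahn A a b c1 c2 d1 d2 K1 K2 \<longleftrightarrow>
     K1 \<in> carrier A \<and> K2 \<in> carrier A \<and> central A d1 \<and>
     commutator A K1 (commutator A K2 K1) =
       a \<odot>\<^bsub>A\<^esub> (K1 \<otimes>\<^bsub>A\<^esub> K1) \<oplus>\<^bsub>A\<^esub> b \<odot>\<^bsub>A\<^esub> K1 \<oplus>\<^bsub>A\<^esub> c1 \<odot>\<^bsub>A\<^esub> K2 \<oplus>\<^bsub>A\<^esub> d1 \<and>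
     commutator A K2 (commutator A K1 K2) =
       a \<odot>\<^bsub>A\<^esub> anticommutator A K1 K2 \<oplus>\<^bsub>A\<^esub> b \<odot>\<^bsub>A\<^esub> K2 \<oplus>\<^bsub>A\<^esub> c2 \<odot>\<^bsub>A\<^esub> K1
         \<oplus>\<^bsub>A\<^esub> d2 \<odot>\<^bsub>A\<^esub> \<one>\<^bsub>A\<^esub>"

end

theory Submission
  imports Defs
begin

text \<open>
  All elements involved are images of noncommutative polynomials under the projection from the free
  algebra, so each claim says that an explicit polynomial lies in the two-sided ideal generated by
  the relators. Such a polynomial is written as a combination \<open>\<Sum> u r v\<close> of the relators \<open>r\<close>, found by
  rewriting to the ordered monomials in \<open>X\<close>, \<open>Z\<close>, \<open>V\<close>. The Casimir element is central because it
  commutes with the generators and its centralizer is a subalgebra.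
\<close>

section \<open>The free algebra\<close>

lemma scalar_simps:
  "scalar 0 = 0" "scalar 1 = 1" "scalar (numeral n) = numeral n"
  "scalar (r + s) = scalar r + scalar s" "scalar (r - s) = scalar r - scalar s"
  "scalar (- r) = - scalar r" "scalar (r * s) = scalar r * scalar s"
  by (simp_all add: scalar_def single_add single_diff single_uminus mult_single)

text \<open>Every word is a product of generators and every polynomial a finite sum of scalar
  multiples of words, so scalars and generators generate the free algebra. This reduces centrality
  to a check on generators.\<close>

lemma free_algebra_induct [case_names scalar gen add mult]:
  assumes scalar: "\<And>r. P (scalar r)"
    and gen: "\<And>g. P (gen g)"
    and add: "\<And>p q. P p \<Longrightarrow> P q \<Longrightarrow> P (p + q)"
    and mult: "\<And>p q. P p \<Longrightarrow> P q \<Longrightarrow> P (p * q)"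
  shows "P (p :: 'g free_algebra)"
proof (induction p rule: Poly_Mapping.update_induct)
  case const
  show ?case using scalar[of 0] by (simp add: scalar_simps)
next
  case (update f a b)
  have word: "P (Poly_Mapping.single (FMon w) 1)" for w :: "'g list"
  proof (induction w)
    case Nil
    show ?case using scalar[of 1] by (simp add: scalar_def zero_fmon_def)
  next
    case (Cons g w)
    have "Poly_Mapping.single (FMon (g # w)) 1 = gen g * Poly_Mapping.single (FMon w) (1 :: real)"
      by (simp add: gen_def mult_single plus_fmon_def)
    then show ?case using gen mult Cons by metis
  qed
  have "Poly_Mapping.single a b = scalar b * Poly_Mapping.single a 1"
    by (simp add: scalar_def mult_single)
  then have "P (Poly_Mapping.single a b)"
    using scalar mult word[of "letters a"] by (metis fmon.collapse)
  \<comment> \<open>The induction supplies \<open>a\<close> outside the support of \<open>f\<close>,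
    so overwriting its coefficient amounts to addition.\<close>
  moreover have "Poly_Mapping.update a b f = f + Poly_Mapping.single a b"
    using update.hyps
    by (intro poly_mapping_eqI)
       (auto simp: lookup_update lookup_add lookup_single in_keys_iff when_def)
  ultimately show ?case using add update.IH by metis
qed

lemma scalar_commute: "p * scalar r = scalar r * p"
proof (induction p rule: free_algebra_induct)
  case (scalar s)
  show ?case by (simp add: mult.commute flip: scalar_simps)
next
  case (gen g)
  show ?case by (simp add: gen_def scalar_def mult_single)
next
  case (add p q)
  then show ?case by (simp add: distrib_left distrib_right)
next
  case (mult p q)
  then show ?case by (metis mult.assoc)
qed

text \<open>Rewrite rules that collect scalars in front of a word while the order of the generators
  stays untouched.\<close>

lemma gen_scalar_commute:
  "gen g * scalar r = scalar r * gen g"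
  "gen g * (scalar r * p) = scalar r * (gen g * p)"
  "scalar s * (scalar r * p) = scalar r * (scalar s * p)"
  by (metis scalar_commute mult.assoc)+

lemma free_alg_sel [simp]:
  "carrier free_alg = UNIV" "x \<otimes>\<^bsub>free_alg\<^esub> y = x * y" "x \<oplus>\<^bsub>free_alg\<^esub> y = x + y"
  "\<one>\<^bsub>free_alg\<^esub> = 1" "\<zero>\<^bsub>free_alg\<^esub> = 0"
  by (simp_all add: free_alg_def)

lemma ring_free_alg: "ring (free_alg :: (real, 'g free_algebra) module)"
proof (rule ringI)
  show "abelian_group (free_alg :: (real, 'g free_algebra) module)"
    by (rule abelian_groupI) (auto simp: add.assoc add.commute intro: exI[of _ "- _"])
  show "Group.monoid (free_alg :: (real, 'g free_algebra) module)"
    by (rule monoidI) (simp_all add: mult.assoc)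
qed (simp_all add: distrib_left distrib_right)

lemma a_inv_free_alg [simp]: "\<ominus>\<^bsub>free_alg\<^esub> x = - x"
proof -
  interpret ring free_alg by (rule ring_free_alg)
  show ?thesis by (rule minus_equality) simp_all
qed

section \<open>Presented algebras\<close>

definition presented_proj :: "'g free_algebra set \<Rightarrow> 'g free_algebra \<Rightarrow> 'g free_algebra set" where
  "presented_proj R p = (Idl\<^bsub>free_alg\<^esub> R) +>\<^bsub>free_alg\<^esub> p"

lemma presented_gen_eq: "presented_gen R g = presented_proj R (gen g)"
  by (simp add: presented_gen_def presented_proj_def)

lemma ideal_genideal_free_alg: "ideal (Idl\<^bsub>free_alg\<^esub> R) free_alg"
  by (rule ring.genideal_ideal[OF ring_free_alg]) simp

text \<open>Shaped as introduction rules, so that membership of a combination of relators reduces to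
  membership of the relators themselves.\<close>

lemma genideal_free_alg_closed:
  assumes "p \<in> Idl\<^bsub>free_alg\<^esub> R"
  shows "q \<in> Idl\<^bsub>free_alg\<^esub> R \<Longrightarrow> p + q \<in> Idl\<^bsub>free_alg\<^esub> R"
    "q \<in> Idl\<^bsub>free_alg\<^esub> R \<Longrightarrow> p - q \<in> Idl\<^bsub>free_alg\<^esub> R"
    "- p \<in> Idl\<^bsub>free_alg\<^esub> R" "q * p \<in> Idl\<^bsub>free_alg\<^esub> R" "p * q \<in> Idl\<^bsub>free_alg\<^esub> R"
proof -
  interpret ideal "Idl\<^bsub>free_alg\<^esub> R" free_alg by (rule ideal_genideal_free_alg)
  show "- p \<in> Idl\<^bsub>free_alg\<^esub> R" using I_l_closed[OF assms, of "- 1"] by simp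
  show "p + q \<in> Idl\<^bsub>free_alg\<^esub> R" if "q \<in> Idl\<^bsub>free_alg\<^esub> R"
    using additive_subgroup.a_closed[OF additive_subgroup_axioms assms that] by simp
  show "p - q \<in> Idl\<^bsub>free_alg\<^esub> R" if "q \<in> Idl\<^bsub>free_alg\<^esub> R"
    using additive_subgroup.a_closed[OF additive_subgroup_axioms assms I_l_closed[OF that, of "- 1"]]
    by simp
  show "q * p \<in> Idl\<^bsub>free_alg\<^esub> R" using I_l_closed[OF assms, of q] by simp
  show "p * q \<in> Idl\<^bsub>free_alg\<^esub> R" using I_r_closed[OF assms, of q] by simp
qed

lemma presented_proj_eqI:
  assumes "p - q \<in> Idl\<^bsub>free_alg\<^esub> R"
  shows "presented_proj R p = presented_proj R q"
proof -
  interpret ideal "Idl\<^bsub>free_alg\<^esub> R" free_alg by (rule ideal_genideal_free_alg)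
  have "p \<in> (Idl\<^bsub>free_alg\<^esub> R) +>\<^bsub>free_alg\<^esub> q"
    using assms by (auto simp: a_r_coset_def' intro!: bexI[of _ "p - q"])
  then show ?thesis
    unfolding presented_proj_def by (intro a_repr_independence'[symmetric]) simp_all
qed

text \<open>The projection is a homomorphism. Read left to right, the rules turn an expression in
  the presented algebra into the image of a single polynomial.\<close>

lemma presented_alg_ops:
  "presented_proj R p \<otimes>\<^bsub>presented_alg R\<^esub> presented_proj R q = presented_proj R (p * q)"
  "presented_proj R p \<oplus>\<^bsub>presented_alg R\<^esub> presented_proj R q = presented_proj R (p + q)"
  "r \<odot>\<^bsub>presented_alg R\<^esub> presented_proj R p = presented_proj R (scalar r * p)"
  "\<one>\<^bsub>presented_alg R\<^esub> = presented_proj R 1"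
  "\<ominus>\<^bsub>presented_alg R\<^esub> presented_proj R p = presented_proj R (- p)"
  "presented_proj R p \<ominus>\<^bsub>presented_alg R\<^esub> presented_proj R q = presented_proj R (p - q)"
  "carrier (presented_alg R) = range (presented_proj R)"
proof -
  let ?I = "Idl\<^bsub>free_alg\<^esub> R"
  interpret ideal ?I free_alg by (rule ideal_genideal_free_alg)
  interpret hom: ring_hom_ring free_alg "free_alg Quot ?I" "(+>\<^bsub>free_alg\<^esub>) ?I"
    by (rule rcos_ring_hom_ring)
  show add: "presented_proj R p \<oplus>\<^bsub>presented_alg R\<^esub> presented_proj R q = presented_proj R (p + q)"
    for p q
    using hom.hom_add[of p q] by (simp add: presented_alg_def presented_proj_def Let_def)
  show "presented_proj R p \<otimes>\<^bsub>presented_alg R\<^esub> presented_proj R q = presented_proj R (p * q)"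
    using hom.hom_mult[of p q] by (simp add: presented_alg_def presented_proj_def Let_def)
  show "r \<odot>\<^bsub>presented_alg R\<^esub> presented_proj R p = presented_proj R (scalar r * p)"
    using hom.hom_mult[of "scalar r" p] by (simp add: presented_alg_def presented_proj_def Let_def)
  show "\<one>\<^bsub>presented_alg R\<^esub> = presented_proj R 1"
    using hom.hom_one by (simp add: presented_alg_def presented_proj_def Let_def)
  \<comment> \<open>Additive inverses depend only on carrier, addition and zero, which
    \<open>presented_alg\<close> copies from the quotient ring.\<close>
  have "a_inv (presented_alg R) = a_inv (free_alg Quot ?I)"
    by (simp add: a_inv_def presented_alg_def Let_def fun_eq_iff m_inv_def)
  then show uminus: "\<ominus>\<^bsub>presented_alg R\<^esub> presented_proj R p = presented_proj R (- p)" for p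
    using hom.hom_a_inv[of p] by (simp add: presented_proj_def)
  show "presented_proj R p \<ominus>\<^bsub>presented_alg R\<^esub> presented_proj R q = presented_proj R (p - q)"
    by (simp add: a_minus_def uminus add)
  show "carrier (presented_alg R) = range (presented_proj R)"
    by (auto simp: presented_alg_def presented_proj_def Let_def FactRing_def A_RCOSETS_def'
        a_r_coset_def')
qed

lemma central_presented_projI:
  assumes gens: "\<And>g. q * gen g - gen g * q \<in> Idl\<^bsub>free_alg\<^esub> R"
  shows "central (presented_alg R) (presented_proj R q)"
proof -
  have "q * p - p * q \<in> Idl\<^bsub>free_alg\<^esub> R" for p
  proof (induction p rule: free_algebra_induct)
    case (scalar r)
    interpret ideal "Idl\<^bsub>free_alg\<^esub> R" free_alg by (rule ideal_genideal_free_alg)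
    show ?case using additive_subgroup.zero_closed[OF additive_subgroup_axioms] by (simp add: scalar_commute)
  next
    case (gen g)
    show ?case by (rule gens)
  next
    case (add p p')
    have "q * (p + p') - (p + p') * q = (q * p - p * q) + (q * p' - p' * q)"
      by (simp add: algebra_simps)
    then show ?case using add genideal_free_alg_closed(1) by metis
  next
    case (mult p p')
    \<comment> \<open>Leibniz rule for the derivation \<open>[q, -]\<close>.\<close>
    have "q * (p * p') - (p * p') * q = (q * p - p * q) * p' + p * (q * p' - p' * q)"
      by (simp add: algebra_simps)
    then show ?case using mult by (metis genideal_free_alg_closed(1,4,5))
  qed
  then show ?thesis
    by (auto simp: central_def presented_alg_ops intro!: presented_proj_eqI)
qed

section \<open>The meta-Hahn algebra\<close>

text \<open>A representative of the coset \<open>Q\<close>, so that computations with it can take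
  place in the free algebra.\<close>

definition casimir_poly :: "real \<Rightarrow> real \<Rightarrow> real \<Rightarrow> mh_gen free_algebra" where
  "casimir_poly \<eta>0 \<eta>1 \<eta>3 =
     (let X = gen GX; Z = gen GZ; V = gen GV
      in (V * (Z * Z + Z) + (Z * Z + Z) * V) + 2 * (X * X) + (2 - scalar \<eta>1) * (Z * Z)
         + scalar \<eta>1 * (X * Z + Z * X) + 2 * scalar \<eta>3 * X + 2 * (scalar \<eta>0 + 1) * Z)"

lemma meta_hahn_casimir_eq:
  "meta_hahn_casimir \<eta>0 \<eta>1 \<eta>3 =
     presented_proj (meta_hahn_relators \<eta>0 \<eta>1 \<eta>3) (casimir_poly \<eta>0 \<eta>1 \<eta>3)"
  by (simp add: meta_hahn_casimir_def meta_hahn_def meta_hahn_gen_def presented_gen_eq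
      anticommutator_def casimir_poly_def presented_alg_ops scalar_simps Let_def)

lemma meta_hahn_ideal_membership:
  fixes \<eta>0 \<eta>1 \<eta>3 \<mu> :: real
  defines "I \<equiv> Idl\<^bsub>free_alg\<^esub> (meta_hahn_relators \<eta>0 \<eta>1 \<eta>3)"
    and "X \<equiv> gen GX" and "Z \<equiv> gen GZ" and "V \<equiv> gen GV"
    and "Q \<equiv> casimir_poly \<eta>0 \<eta>1 \<eta>3"
    and "e0 \<equiv> scalar \<eta>0" and "e1 \<equiv> scalar \<eta>1" and "e3 \<equiv> scalar \<eta>3" and "m \<equiv> scalar \<mu>"
  defines "W \<equiv> X + m * Z" and "b \<equiv> 2 * m - e1 + 2 * e3"
  shows "Q * X - X * Q \<in> I" (is ?QX)
    and "Q * Z - Z * Q \<in> I" (is ?QZ)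
    and "Q * V - V * Q \<in> I" (is ?QV)
    and "(W * (V * W - W * V) - (V * W - W * V) * W)
         - (2 * (W * W) + b * W + (- 1) * V + (- Q + (m * e3 - e0))) \<in> I" (is ?R1)
    and "(V * (W * V - V * W) - (W * V - V * W) * V)
         - (2 * (W * V + V * W) + b * V + (- e1 * (e1 + 2)) * W
            + (e0 * (2 * m - e1) - e1 * e3 * (1 + m))) \<in> I" (is ?R2)
proof -
  define r1 where "r1 = (Z * X - X * Z) - (Z * Z + Z)"
  define r2 where "r2 = (X * V - V * X) - ((V * Z + Z * V) + e1 * X + V - e1 * Z + e0)"
  define r3 where "r3 = (V * Z - Z * V) - (2 * X + e1 * Z + e3)"
  have "meta_hahn_relators \<eta>0 \<eta>1 \<eta>3 \<subseteq> I"
    unfolding I_def by (rule ring.genideal_self[OF ring_free_alg]) simp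
  then have r: "r1 \<in> I" "r2 \<in> I" "r3 \<in> I"
    by (simp_all add: meta_hahn_relators_def r1_def r2_def r3_def Let_def X_def Z_def V_def
        e0_def e1_def e3_def scalar_simps)
  note closed = genideal_free_alg_closed[where R = "meta_hahn_relators \<eta>0 \<eta>1 \<eta>3", folded I_def]
  \<comment> \<open>With scalars moved to the front and \<open>2\<close> unfolded into sums, each
    certificate below becomes an equality between sums of words that \<open>algebra_simps\<close>
    can decide.\<close>
  note [simp] = gen_scalar_commute scalar_commute[of "scalar _"] mult_2 mult_2_right
  note defs = Q_def casimir_poly_def Let_def W_def b_def X_def Z_def V_def
    e0_def e1_def e3_def m_def r1_def r2_def r3_def
  \<comment> \<open>The first six terms are the commutator of \<open>r3 * Z + Z * r3 + r3\<close>
    with \<open>X\<close>; they arise from replacing the anticommutator of \<open>V\<close> and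
    \<open>Z * Z + Z\<close> in \<open>Q\<close> by \<open>2 * (Z * Z + Z) * V\<close>.\<close>
  have "Q * X - X * Q =
      r3 * Z * X + Z * r3 * X + r3 * X - X * r3 * Z - X * Z * r3 - X * r3
      - 2 * (Z * Z + Z) * (r2 + r3) + 2 * (Z * r1 + r1 * Z + r1) * V
      + (e1 + 2) * (r1 * X + X * r1) + 2 * (e0 + e3) * r1"
    by (simp add: defs algebra_simps)
  also have "\<dots> \<in> I" by (intro closed r)
  finally show ?QX .
  \<comment> \<open>Since \<open>Z\<close> commutes with \<open>Z * Z + Z\<close>, the Leibniz rule
    involves only \<open>[V, Z]\<close> and \<open>[X, Z]\<close>; these contribute
    \<open>r3\<close> and \<open>- r1\<close>, and the remaining terms cancel.\<close>
  have "Q * Z - Z * Q =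
      r3 * (Z * Z + Z) + (Z * Z + Z) * r3 - 2 * (r1 * X + X * r1)
      - e1 * (r1 * Z + Z * r1) - 2 * e3 * r1"
    by (simp add: defs algebra_simps)
  also have "\<dots> \<in> I" by (intro closed r)
  finally show ?QZ .
  have "Q * V - V * Q =
      2 * (r2 * X + X * r2) - (V * r3 * Z + r3 * V * Z + Z * V * r3 + Z * r3 * V)
      - V * r3 - r3 * V + e1 * (r3 * Z + Z * r3) + (e1 + 2) * (r2 * Z - X * r3)
      + (e1 - 2) * (Z * r2 - r3 * X) + 2 * e3 * r2 - 2 * e0 * r3"
    by (simp add: defs algebra_simps)
  also have "\<dots> \<in> I" by (intro closed r)
  finally show ?QV .
  \<comment> \<open>The inner commutator \<open>[V, W]\<close> contributes
    \<open>m * r3 - r2\<close>, which appears here inside a commutator with \<open>W\<close>; the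
    other terms come from reordering what remains.\<close>
  have "(W * (V * W - W * V) - (V * W - W * V) * W)
         - (2 * (W * W) + b * W + (- 1) * V + (- Q + (m * e3 - e0))) =
      r2 * X - X * r2 + m * r2 * Z - (m + 2) * Z * r2 - r2 + (m - 1) * (X * r3 - r3 * X)
      + (m * m + m - 1) * Z * r3 + (1 + m - m * m) * r3 * Z + m * r3 + 2 * r1 * V
      + (2 * m * m - 2 * e1 * m - e1 - 2) * r1"
    by (simp add: defs algebra_simps)
  also have "\<dots> \<in> I" by (intro closed r)
  finally show ?R1 .
  \<comment> \<open>Substituting the relations into \<open>[W, V]\<close> and applying
    \<open>[V, -]\<close>, with \<open>[V, {V, Z}] = {V, [V, Z]}\<close>, yields these coefficients
    directly, without reordering.\<close>
  have "(V * (W * V - V * W) - (W * V - V * W) * V)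
         - (2 * (W * V + V * W) + b * V + (- e1 * (e1 + 2)) * W
            + (e0 * (2 * m - e1) - e1 * e3 * (1 + m))) =
      V * r2 - r2 * V + (m + 1) * r3 * V + (1 - m) * V * r3 + (2 * m - e1) * r2
      - e1 * (m + 1) * r3"
    by (simp add: defs algebra_simps)
  also have "\<dots> \<in> I" by (intro closed r)
  finally show ?R2 .
qed

theorem proposition3p1:
  fixes \<eta>0 \<eta>1 \<eta>3 \<mu> :: real
  shows "let H = meta_hahn \<eta>0 \<eta>1 \<eta>3;
             X = meta_hahn_gen \<eta>0 \<eta>1 \<eta>3 GX;
             Z = meta_hahn_gen \<eta>0 \<eta>1 \<eta>3 GZ;
             V = meta_hahn_gen \<eta>0 \<eta>1 \<eta>3 GV;
             Q = meta_hahn_casimir \<eta>0 \<eta>1 \<eta>3;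
             W = X \<oplus>\<^bsub>H\<^esub> \<mu> \<odot>\<^bsub>H\<^esub> Z;
             a = 2;
             b = 2 * \<mu> - \<eta>1 + 2 * \<eta>3;
             c1 = - 1;
             d1 = \<ominus>\<^bsub>H\<^esub> Q \<oplus>\<^bsub>H\<^esub> (\<mu> * \<eta>3 - \<eta>0) \<odot>\<^bsub>H\<^esub> \<one>\<^bsub>H\<^esub>;
             c2 = - \<eta>1 * (\<eta>1 + 2);
             d2 = \<eta>0 * (2 * \<mu> - \<eta>1) - \<eta>1 * \<eta>3 * (1 + \<mu>)
         in centrally_extended_hahn H a b c1 c2 d1 d2 W V"
proof -
  let ?R = "meta_hahn_relators \<eta>0 \<eta>1 \<eta>3" and ?Q = "casimir_poly \<eta>0 \<eta>1 \<eta>3"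
  let ?d1 = "- ?Q + scalar (\<mu> * \<eta>3 - \<eta>0)"
  note mem = meta_hahn_ideal_membership[where ?\<eta>0.0 = \<eta>0 and ?\<eta>1.0 = \<eta>1 and ?\<eta>3.0 = \<eta>3]
  have "central (presented_alg ?R) (presented_proj ?R ?d1)"
  proof (rule central_presented_projI)
    fix g
    have "?Q * gen g - gen g * ?Q \<in> Idl\<^bsub>free_alg\<^esub> ?R"
      using mem(1-3) by (cases g) simp_all
    \<comment> \<open>The scalar summand of \<open>d1\<close> drops out of every commutator, so
      centrality of \<open>d1\<close> is inherited from \<open>Q\<close>.\<close>
    moreover have "?d1 * gen g - gen g * ?d1 = - (?Q * gen g - gen g * ?Q)"
      by (simp add: algebra_simps scalar_commute)
    ultimately show "?d1 * gen g - gen g * ?d1 \<in> Idl\<^bsub>free_alg\<^esub> ?R"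
      by (metis genideal_free_alg_closed(3))
  qed
  with mem(4,5)[of \<mu>] show ?thesis
    unfolding centrally_extended_hahn_def Let_def meta_hahn_casimir_eq
    by (auto simp: meta_hahn_def meta_hahn_gen_def presented_gen_eq presented_alg_ops
        commutator_def anticommutator_def scalar_simps intro!: presented_proj_eqI)
qed

end
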